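(* The rate $$R^*=H\!\left(\tfrac18,\tfrac18,\tfrac38,\tfrac38\right)-H\!\left(\tfrac14,\tfrac12,\tfrac14\right)\approx 0.3113$$ is achievable for fingerprinting under the averaging attack with coalition size $t=3$; that is, for every $0<R<R^*$ there is a sequence (indexed by the code length $n$) of fingerprinting encoders and decoders with $M=\lfloor2^{nR}\rfloor$ users whose misidentification probability tends to $0$ as $n\to\infty$.
   Context: $H(p_1,\dots,p_m)=-\sum_i p_i\log_2 p_i$ is the Shannon entropy in bits. An encoder assigns to each user $u\in\{1,\dots,M\}$ a fingerprint $f(u)\in\{-1,+1\}^n$. Averaging attack with $t=3$: a coalition $U$ of three distinct users with fingerprints $\mathbf{x}_1,\mathbf{x}_2,\mathbf{x}_3$ produces the forged copy $\mathbf{y}=\frac13(\mathbf{x}_1+\mathbf{x}_2+\mathbf{x}_3)\in\{\pm1,\pm\frac13\}^n$ (real addition). A decoder is a map $g:\{\pm1,\pm\frac13\}^n\to\{1,\dots,M\}$. Misidentification is the event $g(\mathbf{y})\notin U$. The misidentification probability is the fraction of the $\binom{M}{3}$ coalitions $U$ of size $3$ for which $g(\mathbf{y})\notin U$. *)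

theory Defs
  imports Complex_Main "HOL-Library.FuncSet"
begin

(* Since ln 0 = 0, zero entries contribute 0, as in the usual convention. *)
definition shannon_entropy :: "real list \<Rightarrow> real" where
  "shannon_entropy ps = - (\<Sum>p\<leftarrow>ps. p * log 2 p)"

(* Vectors of length n are extensional functions on {..<n}; users are {1..M}. *)
definition is_encoder :: "nat \<Rightarrow> nat \<Rightarrow> (nat \<Rightarrow> nat \<Rightarrow> real) \<Rightarrow> bool" where
  "is_encoder n M f \<longleftrightarrow> f \<in> {1..M} \<rightarrow> ({..<n} \<rightarrow>\<^sub>E {-1, 1})"

definition is_decoder :: "nat \<Rightarrow> nat \<Rightarrow> ((nat \<Rightarrow> real) \<Rightarrow> nat) \<Rightarrow> bool" where
  "is_decoder n M g \<longleftrightarrow> g \<in> ({..<n} \<rightarrow>\<^sub>E {-1, -1/3, 1/3, 1}) \<rightarrow> {1..M}"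

definition coalitions :: "nat \<Rightarrow> nat set set" where
  "coalitions M = {U. U \<subseteq> {1..M} \<and> card U = 3}"

definition forged_copy :: "nat \<Rightarrow> (nat \<Rightarrow> nat \<Rightarrow> real) \<Rightarrow> nat set \<Rightarrow> nat \<Rightarrow> real" where
  "forged_copy n f U = (\<lambda>i\<in>{..<n}. 1/3 * (\<Sum>u\<in>U. f u i))"

(* For M < 3 there are no coalitions and the value is 0/0 = 0. *)
definition misid_prob ::
  "nat \<Rightarrow> nat \<Rightarrow> (nat \<Rightarrow> nat \<Rightarrow> real) \<Rightarrow> ((nat \<Rightarrow> real) \<Rightarrow> nat) \<Rightarrow> real" where
  "misid_prob n M f g =
     real (card {U \<in> coalitions M. g (forged_copy n f U) \<notin> U}) / real (M choose 3)"

definition num_users :: "real \<Rightarrow> nat \<Rightarrow> nat" where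
  "num_users R n = nat \<lfloor>2 powr (real n * R)\<rfloor>"

definition achievable :: "real \<Rightarrow> bool" where
  "achievable Rstar \<longleftrightarrow>
     (\<forall>R. 0 < R \<and> R < Rstar \<longrightarrow>
        (\<exists>f g. (\<forall>n. is_encoder n (num_users R n) (f n) \<and> is_decoder n (num_users R n) (g n)) \<and>
           (\<lambda>n. misid_prob n (num_users R n) (f n) (g n)) \<longlonglongrightarrow> 0))"

definition R_star :: real where
  "R_star = shannon_entropy [1/8, 1/8, 3/8, 3/8] - shannon_entropy [1/4, 1/2, 1/4]"

end

theory Submission
  imports Defs
begin

text \<open>
  Random coding with independent uniform signs, one independent column per code position.
  If \<open>u\<close> is a member of the coalition, the posterior probability of \<open>x\<^sub>u = 1\<close> given one
  symbol \<open>y\<close> of the forged copy is \<open>(1 + y) / 2\<close>, so the likelihood ratio of the hypotheses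
  ``\<open>u\<close> is guilty'' and ``\<open>u\<close> is innocent'' is the product of the factors \<open>1 + x\<^sub>u y\<close>.
  The decoder accuses any user whose product exceeds \<open>2\<^sup>n\<^sup>\<gamma>\<close>, where \<open>R < \<gamma> < R\<^sup>*\<close>.
  The product of an innocent user has mean \<open>1\<close>, so Markov's inequality and a union bound give
  at most \<open>M / 2\<^sup>n\<^sup>\<gamma>\<close>. The product of a guilty user is below the threshold with exponentially small
  probability by a Chernoff bound, since its logarithm has mean \<open>n R\<^sup>*\<close>.
\<close>

definition score :: "nat \<Rightarrow> (nat \<Rightarrow> real) \<Rightarrow> (nat \<Rightarrow> real) \<Rightarrow> real" where
  "score n x y = (\<Prod>i<n. 1 + x i * y i)"

text \<open>Position is the first argument of \<open>c\<close>, user the second: a random code is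
  then a function on \<open>{..<n}\<close> whose values are columns, and sums over all codes factor
  position by position.\<close>

definition column_encoder :: "nat \<Rightarrow> (nat \<Rightarrow> nat \<Rightarrow> real) \<Rightarrow> nat \<Rightarrow> nat \<Rightarrow> real" where
  "column_encoder n c u = (\<lambda>i\<in>{..<n}. c i u)"

text \<open>The fallback \<open>1\<close> only keeps the output among the users. Which accused user
  \<open>SOME\<close> picks is irrelevant once no innocent user exceeds \<open>T\<close>.\<close>

definition threshold_decoder ::
  "nat \<Rightarrow> nat \<Rightarrow> (nat \<Rightarrow> nat \<Rightarrow> real) \<Rightarrow> real \<Rightarrow> (nat \<Rightarrow> real) \<Rightarrow> nat" where
  "threshold_decoder n M f T y =
     (if \<exists>u\<in>{1..M}. T < score n (f u) y then SOME u. u \<in> {1..M} \<and> T < score n (f u) y else 1)"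

text \<open>The negative moment of order \<open>s\<close> of a guilty user's factor, which takes the values
  \<open>2\<close>, \<open>4/3\<close>, \<open>2/3\<close> with probabilities \<open>1/4\<close>, \<open>1/2\<close>, \<open>1/4\<close>.\<close>

definition neg_moment :: "real \<Rightarrow> real" where
  "neg_moment s = (2 powr (-s) + 2 * (4/3) powr (-s) + (2/3) powr (-s)) / 4"

section \<open>The rate: numerical value and link to the Chernoff exponent\<close>

lemma R_star_eq: "R_star = 3/2 - 3/4 * log 2 3"
proof -
  have "log 2 8 = (3::real)" "log 2 4 = (2::real)"
    using log_pow_cancel[of 2 3] log_pow_cancel[of 2 2] by simp_all
  then show ?thesis
    by (simp add: R_star_def shannon_entropy_def log_divide field_simps)
qed

lemma R_star_approx: "\<bar>R_star - 0.3113\<bar> < 0.00005"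
proof -
  \<comment> \<open>Comparing 2^84 with 3^53 and 3^200 with 2^317 puts log 2 3 strictly between
    84/53 and 1.585; the latter yields exactly the lower end 0.31125 of the required
    interval.\<close>
  have "84 < 53 * log 2 (3::real)"
  proof -
    have "log 2 (2 ^ 84) < log 2 ((3::real) ^ 53)" by simp
    then show ?thesis by (simp only: log_nat_power zero_less_numeral) simp
  qed
  moreover have "200 * log 2 (3::real) < 317"
  proof -
    have "log 2 ((3::real) ^ 200) < log 2 (2 ^ 317)" by simp
    then show ?thesis by (simp only: log_nat_power zero_less_numeral) simp
  qed
  ultimately show ?thesis by (simp add: R_star_eq abs_if)
qed

text \<open>The function of \<open>s\<close> equals 1 at 0 and has slope
  \<open>ln 2 * (\<gamma> - R_star) < 0\<close> there, so it drops below 1 just to the right of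
  0.\<close>

lemma neg_moment_small:
  assumes "\<gamma> < R_star"
  obtains s where "s > 0" "2 powr (\<gamma> * s) * neg_moment s < 1"
proof -
  let ?\<phi> = "\<lambda>s. 2 powr (\<gamma> * s) * neg_moment s"
  have "(?\<phi> has_real_derivative
      ln 2 * \<gamma> - (ln 2 + 2 * ln (4/3) + ln (2/3)) / 4) (at 0)"
    unfolding neg_moment_def by (auto intro!: derivative_eq_intros simp: field_simps)
  \<comment> \<open>The mean natural logarithm of a guilty user's factor is \<open>R_star\<close>
    converted from bits to nats.\<close>
  moreover have "(ln 2 + 2 * ln (4/3) + ln (2/3)) / 4 = ln 2 * R_star"
  proof -
    have "ln (4::real) = 2 * ln 2" using ln_realpow[of 2 2] by simp
    then show ?thesis by (simp add: R_star_eq log_def ln_div field_simps)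
  qed
  ultimately have "(?\<phi> has_real_derivative ln 2 * \<gamma> - ln 2 * R_star) (at 0)" by simp
  moreover have "ln 2 * \<gamma> - ln 2 * R_star < 0" using assms by simp
  ultimately obtain d where d: "d > 0" "\<forall>h>0. h < d \<longrightarrow> ?\<phi> 0 > ?\<phi> (0 + h)"
    using DERIV_neg_dec_right by blast
  then have "?\<phi> (d/2) < ?\<phi> 0" using d(2)[rule_format, of "d/2"] by simp
  then show ?thesis using that[of "d/2"] d(1) by (simp add: neg_moment_def)
qed

section \<open>Moments of the score factors over uniform random columns\<close>

lemma sum_PiE_remove:
  assumes "v \<in> A"
  shows "(\<Sum>c\<in>A \<rightarrow>\<^sub>E B. H c) = (\<Sum>b\<in>B. \<Sum>c\<in>(A - {v}) \<rightarrow>\<^sub>E B. H (c(v := b)))"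
proof -
  have "A \<rightarrow>\<^sub>E B = (\<lambda>(b, c). c(v := b)) ` (B \<times> ((A - {v}) \<rightarrow>\<^sub>E B))"
    using PiE_insert_eq[of v "A - {v}" "\<lambda>_. B"] assms by (simp add: insert_absorb)
  moreover have "inj_on (\<lambda>(b, c). c(v := b)) (B \<times> ((A - {v}) \<rightarrow>\<^sub>E B))"
    by (rule inj_combinator) simp
  ultimately show ?thesis
    by (simp add: sum.reindex sum.cartesian_product case_prod_unfold)
qed

lemma sum_prod_columns:
  fixes h :: "'a \<Rightarrow> real"
  assumes "finite S"
  shows "(\<Sum>c\<in>{..<n} \<rightarrow>\<^sub>E S. \<Prod>i<n. h (c i)) = (\<Sum>x\<in>S. h x) ^ n"
  using prod_sum_PiE[of "{..<n}" "\<lambda>_. S" "\<lambda>_. h"] assms by simp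

text \<open>The coalition average t does not depend on the sign of \<open>v\<close>, so the two
  choices of that sign contribute (1 + t) + (1 - t) = 2 for each assignment to the other
  users.\<close>

lemma sum_innocent_factor:
  assumes "finite A" "v \<in> A" "v \<notin> U"
  shows "(\<Sum>c\<in>A \<rightarrow>\<^sub>E {-1, 1::real}. 1 + c v * (1/3 * (\<Sum>u\<in>U. c u))) = 2 ^ card A"
proof -
  have "(\<Sum>u\<in>U. (c(v := b)) u) = (\<Sum>u\<in>U. c u)" for c and b :: real
    using assms(3) by (intro sum.cong) auto
  then have "(\<Sum>c\<in>A \<rightarrow>\<^sub>E {-1, 1}. 1 + c v * (1/3 * (\<Sum>u\<in>U. c u)))
      = 2 * real (card ((A - {v}) \<rightarrow>\<^sub>E {-1, 1::real}))"
    using assms(2) by (simp add: sum_PiE_remove[of v] flip: sum.distrib)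
  also have "\<dots> = 2 ^ card A"
    using assms card_Suc_Diff1[of A v] by (simp add: card_funcsetE flip: power_Suc)
  finally show ?thesis .
qed

text \<open>As the square of \<open>c a\<close> is 1, the factor is 4/3 + c a * (c b + c d) / 3 for
  the other two members b and d. The eight sign patterns of the coalition give 2, 4/3, 2/3 with
  multiplicities 2, 4, 2; users outside it only contribute a power of two.\<close>

lemma sum_guilty_factor:
  assumes "finite A" "U \<subseteq> A" "card U = 3" "a \<in> U"
  shows "(\<Sum>c\<in>A \<rightarrow>\<^sub>E {-1, 1::real}. (1 + c a * (1/3 * (\<Sum>u\<in>U. c u))) powr (-s))
    = 2 ^ card A * neg_moment s"
proof -
  obtain b d where U: "U = {a, b, d}" and ne: "a \<noteq> b" "a \<noteq> d" "b \<noteq> d"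
  proof -
    have "card (U - {a}) = 2" using assms by simp
    then obtain b d where "U - {a} = {b, d}" "b \<noteq> d" by (auto simp: card_2_iff)
    with that[of b d] assms(4) show ?thesis by blast
  qed
  have "card A = Suc (Suc (Suc (card (A - {a} - {b} - {d}))))"
    using assms(1,2) U ne card_Suc_Diff1[of A a] card_Suc_Diff1[of "A - {a}" b]
      card_Suc_Diff1[of "A - {a} - {b}" d] by simp
  then have pow: "2 ^ card A = 8 * (2::real) ^ card (A - {a} - {b} - {d})" by simp
  show ?thesis
    using assms(1,2) U ne unfolding pow
    by (simp add: sum_PiE_remove[of a] sum_PiE_remove[of b] sum_PiE_remove[of d]
        card_funcsetE neg_moment_def field_simps)
qed

section \<open>Admissibility of encoder and decoder, and signs of the factors\<close>

lemma num_users_pos: "0 \<le> R \<Longrightarrow> 1 \<le> num_users R n"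
  by (simp add: num_users_def le_nat_iff ge_one_powr_ge_zero)

lemma num_users_le: "real (num_users R n) \<le> 2 powr (real n * R)"
  by (simp add: num_users_def)

lemma column_encoder_is_encoder:
  assumes "c \<in> {..<n} \<rightarrow>\<^sub>E ({1..M} \<rightarrow>\<^sub>E {-1, 1})"
  shows "is_encoder n M (column_encoder n c)"
  unfolding is_encoder_def column_encoder_def using assms by (fastforce simp: PiE_iff)

lemma threshold_decoder_in_users:
  assumes "1 \<le> M"
  shows "threshold_decoder n M f T y \<in> {1..M}"
proof (cases "\<exists>u\<in>{1..M}. T < score n (f u) y")
  case True
  then have "\<exists>u. u \<in> {1..M} \<and> T < score n (f u) y" by blast
  from someI_ex[OF this] True show ?thesis by (simp add: threshold_decoder_def)
next
  case False
  with assms show ?thesis by (simp add: threshold_decoder_def)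
qed

lemma threshold_decoder_correct:
  assumes "a \<in> {1..M}" "T < score n (f a) y"
    and "\<And>v. v \<in> {1..M} - U \<Longrightarrow> score n (f v) y \<le> T"
  shows "threshold_decoder n M f T y \<in> U"
proof -
  have ex: "\<exists>u. u \<in> {1..M} \<and> T < score n (f u) y" using assms by blast
  then have eq: "threshold_decoder n M f T y = (SOME u. u \<in> {1..M} \<and> T < score n (f u) y)"
    by (auto simp: threshold_decoder_def)
  from someI_ex[OF ex, folded eq] assms(3) show ?thesis by force
qed

lemma score_column_encoder:
  "score n (column_encoder n c v) (forged_copy n (column_encoder n c) U)
    = (\<Prod>i<n. 1 + c i v * (1/3 * (\<Sum>u\<in>U. c i u)))"
  by (simp add: score_def column_encoder_def forged_copy_def)

lemma coalition_sum_bound: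
  assumes "U \<in> coalitions M" "x \<in> {1..M} \<rightarrow>\<^sub>E {-1, 1::real}"
  shows "\<bar>1/3 * (\<Sum>u\<in>U. x u)\<bar> \<le> 1"
proof -
  have "\<bar>\<Sum>u\<in>U. x u\<bar> \<le> (\<Sum>u\<in>U. \<bar>x u\<bar>)" by (rule sum_abs)
  also have "\<dots> \<le> (\<Sum>u\<in>U. 1)"
    using assms by (intro sum_mono) (fastforce simp: coalitions_def PiE_iff)
  finally show ?thesis using assms by (simp add: coalitions_def abs_mult)
qed

lemma factor_nonneg:
  assumes "U \<in> coalitions M" "x \<in> {1..M} \<rightarrow>\<^sub>E {-1, 1::real}" "v \<in> {1..M}"
  shows "0 \<le> 1 + x v * (1/3 * (\<Sum>u\<in>U. x u))"
proof -
  have "x v = -1 \<or> x v = 1" using assms by (auto simp: PiE_iff)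
  with coalition_sum_bound[OF assms(1,2)] show ?thesis by (auto simp: abs_le_iff)
qed

text \<open>A member agrees with itself, so the other two can lower the factor only to 2/3. An
  innocent user's factor can vanish; strict positivity is what makes the negative power of a guilty
  score meaningful.\<close>

lemma guilty_factor_pos:
  assumes "U \<in> coalitions M" "x \<in> {1..M} \<rightarrow>\<^sub>E {-1, 1::real}" "a \<in> U"
  shows "0 < 1 + x a * (1/3 * (\<Sum>u\<in>U. x u))"
proof -
  have U: "finite U" "U \<subseteq> {1..M}" "card U = 3"
    using assms by (auto simp: coalitions_def intro: card_ge_0_finite)
  have "\<bar>\<Sum>u\<in>U - {a}. x u\<bar> \<le> (\<Sum>u\<in>U - {a}. \<bar>x u\<bar>)" by (rule sum_abs)
  also have "\<dots> \<le> (\<Sum>u\<in>U - {a}. 1)"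
    using assms U by (intro sum_mono) (fastforce simp: PiE_iff)
  finally have "\<bar>\<Sum>u\<in>U - {a}. x u\<bar> \<le> 2" using assms U by simp
  moreover have "(\<Sum>u\<in>U. x u) = x a + (\<Sum>u\<in>U - {a}. x u)"
    using U assms by (simp add: sum.remove)
  moreover have "x a = -1 \<or> x a = 1" using assms U by (auto simp: PiE_iff)
  ultimately show ?thesis by (auto simp: abs_le_iff field_simps)
qed

section \<open>Error bound for one coalition, then averaging over codes\<close>

lemma misid_indicator_le:
  fixes n M c U T a
  defines "f \<equiv> column_encoder n c"
  defines "w \<equiv> \<lambda>v. score n (f v) (forged_copy n f U)"
  assumes c: "c \<in> {..<n} \<rightarrow>\<^sub>E ({1..M} \<rightarrow>\<^sub>E {-1, 1})"
    and U: "U \<in> coalitions M" and a: "a \<in> U" and T: "0 < T" and s: "0 < s"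
  shows "of_bool (threshold_decoder n M f T (forged_copy n f U) \<notin> U)
    \<le> T powr s * w a powr (-s) + (\<Sum>v\<in>{1..M} - U. w v / T)"
proof -
  have w_nonneg: "0 \<le> w v" if "v \<in> {1..M}" for v
    unfolding w_def f_def score_column_encoder using factor_nonneg[OF U _ that] c
    by (intro prod_nonneg) (auto simp: PiE_iff[of c])
  have w_pos: "0 < w a"
    unfolding w_def f_def score_column_encoder using guilty_factor_pos[OF U _ a] c
    by (intro prod_pos) (auto simp: PiE_iff[of c])
  have sum_nonneg: "0 \<le> (\<Sum>v\<in>{1..M} - U. w v / T)"
    using w_nonneg T by (intro sum_nonneg) auto
  show ?thesis
  proof (cases "threshold_decoder n M f T (forged_copy n f U) \<in> U")
    case True
    then show ?thesis using sum_nonneg by simp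
  next
    case False
    have "a \<in> {1..M}" using U a by (auto simp: coalitions_def)
    with False threshold_decoder_correct[of a M T n f "forged_copy n f U" U]
    consider "w a \<le> T" | v where "v \<in> {1..M} - U" "T < w v"
      unfolding w_def by fastforce
    then show ?thesis
    proof cases
      case 1
      \<comment> \<open>Pointwise Chernoff bound: a ratio \<open>T / w a\<close> of at least 1 stays
        so when raised to a positive power.\<close>
      have "1 \<le> (T / w a) powr s" using 1 w_pos s by (intro ge_one_powr_ge_zero) auto
      also have "\<dots> = T powr s * w a powr (-s)"
        using w_pos T by (simp add: powr_divide powr_minus_divide)
      finally show ?thesis using sum_nonneg False by simp
    next
      case 2
      \<comment> \<open>Pointwise Markov bound, with the union bound over innocent users built into
        the sum.\<close>
      have "1 \<le> w v / T" using 2 T by simp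
      also have "\<dots> \<le> (\<Sum>v\<in>{1..M} - U. w v / T)"
        using 2 w_nonneg T by (intro member_le_sum) auto
      finally show ?thesis using False by (simp add: add_increasing)
    qed
  qed
qed

text \<open>An expectation over random codes, written as a plain sum over the finite set
  \<open>Cs\<close>; the factor \<open>card Cs\<close> replaces the normalisation.\<close>

lemma misid_expectation_le:
  fixes n M U T s
  defines "Cs \<equiv> {..<n} \<rightarrow>\<^sub>E ({1..M} \<rightarrow>\<^sub>E {-1, 1::real})"
  assumes U: "U \<in> coalitions M" and T: "0 < T" and s: "0 < s"
  shows "(\<Sum>c\<in>Cs. of_bool (threshold_decoder n M (column_encoder n c) T
        (forged_copy n (column_encoder n c) U) \<notin> U))
    \<le> real (card Cs) * (T powr s * neg_moment s ^ n + real M / T)"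
proof -
  let ?S = "{1..M} \<rightarrow>\<^sub>E {-1, 1::real}"
  define w where "w v c = (\<Prod>i<n. 1 + c i v * (1/3 * (\<Sum>u\<in>U. c i u)))"
    for v :: nat and c :: "nat \<Rightarrow> nat \<Rightarrow> real"
  have U': "U \<subseteq> {1..M}" "card U = 3" using U by (auto simp: coalitions_def)
  then obtain a where a: "a \<in> U" by fastforce
  have fin: "finite ?S" by (intro finite_PiE) auto
  have card: "real (card Cs) = (2 ^ M) ^ n"
    unfolding Cs_def by (simp add: card_funcsetE)
  have innocent: "(\<Sum>c\<in>Cs. w v c) = real (card Cs)" if "v \<in> {1..M} - U" for v
    unfolding card unfolding w_def Cs_def
    using sum_prod_columns[OF fin, where n = n and h = "\<lambda>x. 1 + x v * (1/3 * (\<Sum>u\<in>U. x u))"]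
      sum_innocent_factor[of "{1..M}" v U] that by simp
  have "(\<Sum>c\<in>Cs. w a c powr (-s))
      = (\<Sum>c\<in>Cs. \<Prod>i<n. (1 + c i a * (1/3 * (\<Sum>u\<in>U. c i u))) powr (-s))"
    unfolding w_def by (simp only: prod_powr_distrib)
  also have "\<dots> = real (card Cs) * neg_moment s ^ n"
    unfolding card unfolding Cs_def
    using sum_prod_columns[OF fin, where n = n and h = "\<lambda>x. (1 + x a * (1/3 * (\<Sum>u\<in>U. x u))) powr (-s)"]
      sum_guilty_factor[of "{1..M}" U a s] U' a by (simp add: power_mult_distrib)
  finally have guilty: "(\<Sum>c\<in>Cs. w a c powr (-s)) = real (card Cs) * neg_moment s ^ n" .
  have "(\<Sum>c\<in>Cs. of_bool (threshold_decoder n M (column_encoder n c) T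
        (forged_copy n (column_encoder n c) U) \<notin> U))
      \<le> (\<Sum>c\<in>Cs. T powr s * w a c powr (-s) + (\<Sum>v\<in>{1..M} - U. w v c / T))"
    unfolding w_def Cs_def
    by (intro sum_mono misid_indicator_le[OF _ U a T s, unfolded score_column_encoder])
  also have "\<dots> = T powr s * (\<Sum>c\<in>Cs. w a c powr (-s))
      + (\<Sum>v\<in>{1..M} - U. (\<Sum>c\<in>Cs. w v c) / T)"
    by (simp add: sum.distrib sum.swap[of _ _ Cs] sum_distrib_left sum_divide_distrib)
  also have "\<dots> = real (card Cs) * (T powr s * neg_moment s ^ n)
      + real (card ({1..M} - U)) * (real (card Cs) / T)"
    by (simp add: guilty innocent)
  also have "\<dots> \<le> real (card Cs) * (T powr s * neg_moment s ^ n)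
      + real M * (real (card Cs) / T)"
    using card_mono[of "{1..M}" "{1..M} - U"] T by (intro add_left_mono mult_right_mono) auto
  finally show ?thesis by (simp add: algebra_simps)
qed

text \<open>Every coalition has mean error at most the bound, hence so does the average over
  coalitions, and some code does no worse than the mean.\<close>

lemma good_code_exists:
  assumes T: "0 < T" and s: "0 < s"
  obtains f where "is_encoder n M f"
    "misid_prob n M f (threshold_decoder n M f T) \<le> T powr s * neg_moment s ^ n + real M / T"
proof -
  let ?Cs = "{..<n} \<rightarrow>\<^sub>E ({1..M} \<rightarrow>\<^sub>E {-1, 1::real})"
  let ?\<epsilon> = "T powr s * neg_moment s ^ n + real M / T"
  let ?bad = "\<lambda>c U. threshold_decoder n M (column_encoder n c) T
        (forged_copy n (column_encoder n c) U) \<notin> U"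
  let ?p = "\<lambda>c. misid_prob n M (column_encoder n c) (threshold_decoder n M (column_encoder n c) T)"
  have fin: "finite (coalitions M)"
    by (rule finite_subset[of _ "Pow {1..M}"]) (auto simp: coalitions_def)
  have card: "card (coalitions M) = M choose 3"
    unfolding coalitions_def using n_subsets[of "{1..M}" 3] by simp
  have eps: "0 \<le> ?\<epsilon>" using T by (simp add: neg_moment_def)
  have p_eq: "?p c = (\<Sum>U\<in>coalitions M. of_bool (?bad c U)) / real (M choose 3)" for c
    using fin by (simp add: misid_prob_def Int_def)
  have "(\<Sum>c\<in>?Cs. ?p c)
      = (\<Sum>U\<in>coalitions M. \<Sum>c\<in>?Cs. of_bool (?bad c U)) / real (M choose 3)"
    unfolding p_eq by (simp only: sum.swap[of _ ?Cs] flip: sum_divide_distrib)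
  also have "\<dots> \<le> (\<Sum>U\<in>coalitions M. real (card ?Cs) * ?\<epsilon>) / real (M choose 3)"
    using T s by (intro divide_right_mono sum_mono misid_expectation_le) auto
  \<comment> \<open>Equality fails to be automatic only for \<open>M < 3\<close>: the left side is
    then 0/0 = 0, and nonnegativity of the bound suffices.\<close>
  also have "\<dots> \<le> real (card ?Cs) * ?\<epsilon>"
    using eps by (simp add: card)
  finally have le: "(\<Sum>c\<in>?Cs. ?p c) \<le> (\<Sum>c\<in>?Cs. ?\<epsilon>)" by simp
  have "?Cs \<noteq> {}" "finite ?Cs" by (auto simp: PiE_eq_empty_iff intro!: finite_PiE)
  then obtain c where "c \<in> ?Cs" "?p c \<le> ?\<epsilon>"
    using le sum_strict_mono[of ?Cs "\<lambda>_. ?\<epsilon>" ?p] by (meson not_le)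
  then show ?thesis using that column_encoder_is_encoder by blast
qed

lemma achievable_R_star: "achievable R_star"
  unfolding achievable_def
proof (intro allI impI)
  fix R assume R: "0 < R \<and> R < R_star"
  then obtain \<gamma> where \<gamma>: "R < \<gamma>" "\<gamma> < R_star" using dense by blast
  obtain s where s: "s > 0" and small: "2 powr (\<gamma> * s) * neg_moment s < 1"
    using neg_moment_small[OF \<gamma>(2)] .
  define M where "M = num_users R"
  define T where "T n = 2 powr (real n * \<gamma>)" for n
  define \<rho> where "\<rho> = 2 powr (\<gamma> * s) * neg_moment s"
  define \<epsilon> where "\<epsilon> n = T n powr s * neg_moment s ^ n + real (M n) / T n" for n
  have "\<exists>f. is_encoder n (M n) f \<and>
      misid_prob n (M n) f (threshold_decoder n (M n) f (T n)) \<le> \<epsilon> n" for n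
    using good_code_exists[of "T n" s n "M n"] s unfolding \<epsilon>_def T_def by auto
  then obtain f where f: "\<And>n. is_encoder n (M n) (f n)"
    "\<And>n. misid_prob n (M n) (f n) (threshold_decoder n (M n) (f n) (T n)) \<le> \<epsilon> n"
    by metis
  define g where "g n = threshold_decoder n (M n) (f n) (T n)" for n
  have g: "is_decoder n (M n) (g n)" for n
    using threshold_decoder_in_users num_users_pos R
    unfolding is_decoder_def g_def M_def by (simp add: Pi_iff)
  \<comment> \<open>Both error terms are geometric: the guilty one has ratio \<open>\<rho>\<close>,
    below 1 by the choice of \<open>s\<close>, and the innocent one has ratio
    \<open>2 powr (R - \<gamma>)\<close>, below 1 since \<open>R < \<gamma>\<close>.\<close>
  have eps_le: "\<epsilon> n \<le> \<rho> ^ n + (2 powr (R - \<gamma>)) ^ n" for n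
  proof -
    have "T n powr s * neg_moment s ^ n = \<rho> ^ n"
      by (simp add: T_def \<rho>_def power_mult_distrib powr_powr powr_power mult_ac)
    moreover have "real (M n) / T n \<le> 2 powr (real n * R) / T n"
      unfolding M_def T_def by (intro divide_right_mono num_users_le) simp
    moreover have "2 powr (real n * R) / T n = (2 powr (R - \<gamma>)) ^ n"
      by (simp add: T_def powr_power algebra_simps flip: powr_diff)
    ultimately show ?thesis unfolding \<epsilon>_def by linarith
  qed
  have "(\<lambda>n. \<rho> ^ n + (2 powr (R - \<gamma>)) ^ n) \<longlonglongrightarrow> 0 + 0"
  proof (intro tendsto_add LIMSEQ_realpow_zero)
    show "0 \<le> \<rho>" by (simp add: \<rho>_def neg_moment_def)
    show "\<rho> < 1" using small by (simp add: \<rho>_def)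
    show "2 powr (R - \<gamma>) < 1" using \<gamma>(1) powr_less_mono[of "R - \<gamma>" 0 2] by simp
  qed simp
  then have lim: "(\<lambda>n. \<rho> ^ n + (2 powr (R - \<gamma>)) ^ n) \<longlonglongrightarrow> 0" by simp
  have "(\<lambda>n. misid_prob n (M n) (f n) (g n)) \<longlonglongrightarrow> 0"
  proof (rule tendsto_sandwich[OF _ _ tendsto_const lim])
    show "\<forall>\<^sub>F n in sequentially. 0 \<le> misid_prob n (M n) (f n) (g n)"
      by (simp add: misid_prob_def)
    show "\<forall>\<^sub>F n in sequentially.
        misid_prob n (M n) (f n) (g n) \<le> \<rho> ^ n + (2 powr (R - \<gamma>)) ^ n"
      using order_trans[OF f(2) eps_le] unfolding g_def by (intro always_eventually) blast
  qed
  with f(1) g show "\<exists>f g. (\<forall>n. is_encoder n (num_users R n) (f n) \<and>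
        is_decoder n (num_users R n) (g n)) \<and>
      (\<lambda>n. misid_prob n (num_users R n) (f n) (g n)) \<longlonglongrightarrow> 0"
    unfolding M_def by blast
qed

theorem theorem3:
  "\<bar>R_star - 0.3113\<bar> < 0.00005 \<and> achievable R_star"
  using R_star_approx achievable_R_star by blast

end
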